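(* Let $\theta\in(0,1)$, $\alpha\in(0,1)$ and $\Lambda\in(0,\infty)$. Then the free boundary problem $$ \begin{cases} u_{\xi\xi}-cu_{\xi}=-v^{\alpha}, & \Lambda v_{\xi\xi}-c v_{\xi}=v^{\alpha},\quad v>0, \quad \xi\in(-R,0),\\ u(-R)=\theta, & u_{\xi}(-R)=c\theta,\\ u(0)=1, & u_{\xi}(0)=0,\quad v(0)=v_{\xi}(0)=0, \end{cases} $$ admits a unique solution; that is, there exists exactly one quadruple $(c,R,u,v)$ with $c>0$, $R>0$, and $u,v:[-R,0]\to\mathbb{R}$ satisfying $u_{\xi\xi}-cu_{\xi}=-v^{\alpha}$, $\Lambda v_{\xi\xi}-cv_{\xi}=v^{\alpha}$ and $v>0$ on $(-R,0)$, together with the boundary conditions $u(-R)=\theta$, $u_{\xi}(-R)=c\theta$, $u(0)=1$, $u_{\xi}(0)=0$ and $v(0)=v_{\xi}(0)=0$.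
   Context: The unknowns of the problem are the speed $c>0$, the length $R>0$ of the reaction zone, and the functions $u,v$ on $[-R,0]$; none of these is prescribed in advance. Solutions are understood classically: $u,v\in C^2((-R,0))\cap C^1([-R,0])$, the differential equations hold pointwise on $(-R,0)$, and the boundary conditions hold for the (one-sided) values of the functions and their first derivatives at the endpoints $\xi=-R$ and $\xi=0$. Subscripts $\xi$ denote derivatives with respect to $\xi$. *)

theory Defs
  imports "HOL-Analysis.Analysis"
begin

text \<open>
  \<open>C2_C1_derivs a b f f' f''\<close>: the function \<open>f\<close> belongs to
  $C^2((a,b)) \cap C^1([a,b])$, with first derivative \<open>f'\<close> on \<open>[a,b]\<close> (one-sided at the
  endpoints, by the filter \<open>at x within {a..b}\<close>) and second derivative \<open>f''\<close> on \<open>(a,b)\<close>.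
\<close>

definition C2_C1_derivs ::
  "real \<Rightarrow> real \<Rightarrow> (real \<Rightarrow> real) \<Rightarrow> (real \<Rightarrow> real) \<Rightarrow> (real \<Rightarrow> real) \<Rightarrow> bool" where
  "C2_C1_derivs a b f f' f'' \<longleftrightarrow>
     (\<forall>x\<in>{a..b}. (f has_real_derivative f' x) (at x within {a..b})) \<and>
     continuous_on {a..b} f' \<and>
     (\<forall>x\<in>{a<..<b}. (f' has_real_derivative f'' x) (at x)) \<and>
     continuous_on {a<..<b} f''"

text \<open>
  A function on \<open>[-R,0]\<close> is represented by a total function that is \<open>undefined\<close> outside
  \<open>[-R,0]\<close> (membership in \<open>extensional\<close>), so that equality of the representing functions is
  equality of functions on \<open>[-R,0]\<close>. The values outside the interval enter no other condition.
\<close>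

definition fbp_solution ::
  "real \<Rightarrow> real \<Rightarrow> real \<Rightarrow> real \<Rightarrow> real \<Rightarrow> (real \<Rightarrow> real) \<Rightarrow> (real \<Rightarrow> real) \<Rightarrow> bool" where
  "fbp_solution \<theta> \<alpha> \<Lambda> c R u v \<longleftrightarrow>
     0 < c \<and> 0 < R \<and>
     u \<in> extensional {-R..0} \<and> v \<in> extensional {-R..0} \<and>
     (\<exists>u' u'' v' v''.
        C2_C1_derivs (-R) 0 u u' u'' \<and> C2_C1_derivs (-R) 0 v v' v'' \<and>
        (\<forall>\<xi>\<in>{-R<..<0}.
            u'' \<xi> - c * u' \<xi> = - (v \<xi> powr \<alpha>) \<and>
            \<Lambda> * v'' \<xi> - c * v' \<xi> = v \<xi> powr \<alpha> \<and>
            0 < v \<xi>) \<and>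
        u (-R) = \<theta> \<and> u' (-R) = c * \<theta> \<and>
        u 0 = 1 \<and> u' 0 = 0 \<and> v 0 = 0 \<and> v' 0 = 0)"

end

theory Submission
  imports Defs
begin

text \<open>
  Put \<open>y = - c \<xi> / \<Lambda>\<close> and \<open>v = k W(y)\<close> with \<open>k\<^bsup>1-\<alpha>\<^esup> = \<Lambda> / c\<^sup>2\<close>. Then \<open>W\<close> is the positive
  solution of the parameter-free problem \<open>W'' + W' = W\<^bsup>\<alpha>\<^esup>\<close>, \<open>W(0) = W'(0) = 0\<close>. With \<open>g = W\<^bsup>\<alpha>\<^esup>\<close>,
  \<open>G = W + W'\<close> (so \<open>G' = g\<close>) and \<open>A' + \<Lambda> A = g\<close>, \<open>A(0) = 0\<close>, one has \<open>u = 1 - k (G - A)\<close> and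
  \<open>u\<^sub>\<xi> = c k A\<close>, and the conditions at \<open>\<xi> = -R\<close> become \<open>k G(S) = 1\<close> and \<open>A(S) / G(S) = \<theta>\<close> for
  \<open>S = c R / \<Lambda>\<close>. The theorem thus reduces to two facts.

  Existence and uniqueness of \<open>W\<close>: the power nonlinearity is not Lipschitz at \<open>0\<close>, but its Green operator
  is homogeneous of degree \<open>\<alpha> < 1\<close> and monotone, hence a contraction for the logarithm of the ratio to a
  fixed weight. Uniqueness compares one solution with a small translate of another.

  \<open>A / G\<close> decreases strictly from \<open>1\<close> to \<open>0\<close>: this follows from \<open>G\<close> being strictly log-concave, and
  the latter holds because \<open>Q = W\<^bsup>1+\<alpha>\<^esup> - \<alpha> W W' - \<alpha> W'\<^sup>2\<close> satisfies
  \<open>Q' + Q = (1 - \<alpha>) W\<^bsup>\<alpha>\<^esup> (W + W') > 0\<close>.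
\<close>

subsection \<open>First-order linear differential inequalities\<close>

text \<open>The integrating factor \<open>exp (c * x)\<close> turns the inequality into
  monotonicity. Derivatives are taken in the open interval only, because \<open>g\<close> and the
  quotient in \<open>A_greater\<close> are controlled at 0 merely by continuity.\<close>

lemma pos_of_linear_deriv_pos:
  fixes f f' :: "real \<Rightarrow> real"
  assumes "a < b" "continuous_on {a..b} f" "0 \<le> f a"
    and "\<And>x. a < x \<Longrightarrow> x < b \<Longrightarrow> (f has_real_derivative f' x) (at x)"
    and "\<And>x. a < x \<Longrightarrow> x < b \<Longrightarrow> 0 < f' x + c * f x"
  shows "0 < f b"
proof -
  have "exp (c * a) * f a < exp (c * b) * f b"
  proof (rule DERIV_pos_imp_increasing_open[OF \<open>a < b\<close>, of "\<lambda>x. exp (c * x) * f x"])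
    fix x assume x: "a < x" "x < b"
    have "((\<lambda>x. exp (c * x) * f x) has_real_derivative exp (c * x) * (f' x + c * f x)) (at x)"
      by (rule derivative_eq_intros assms(4) x refl | simp add: algebra_simps)+
    then show "\<exists>y. ((\<lambda>x. exp (c * x) * f x) has_real_derivative y) (at x) \<and> 0 < y"
      using assms(5)[OF x] by (intro exI[of _ "exp (c * x) * (f' x + c * f x)"]) auto
  qed (intro continuous_intros assms)
  moreover have "0 \<le> exp (c * a) * f a" using assms(3) by simp
  ultimately have "0 < exp (c * b) * f b" by linarith
  then show ?thesis by (simp add: zero_less_mult_iff)
qed

lemma nonneg_of_linear_deriv_nonneg:
  fixes f f' :: "real \<Rightarrow> real"
  assumes "a \<le> b" "continuous_on {a..b} f" "0 \<le> f a"
    and "\<And>x. a < x \<Longrightarrow> x < b \<Longrightarrow> (f has_real_derivative f' x) (at x)"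
    and "\<And>x. a < x \<Longrightarrow> x < b \<Longrightarrow> 0 \<le> f' x + c * f x"
  shows "0 \<le> f b"
proof -
  have "exp (c * a) * f a \<le> exp (c * b) * f b"
  proof (rule DERIV_nonneg_imp_increasing_open[OF \<open>a \<le> b\<close>, of "\<lambda>x. exp (c * x) * f x"])
    fix x assume x: "a < x" "x < b"
    have "((\<lambda>x. exp (c * x) * f x) has_real_derivative exp (c * x) * (f' x + c * f x)) (at x)"
      by (rule derivative_eq_intros assms(4) x refl | simp add: algebra_simps)+
    then show "\<exists>y. ((\<lambda>x. exp (c * x) * f x) has_real_derivative y) (at x) \<and> 0 \<le> y"
      using assms(5)[OF x] by (intro exI[of _ "exp (c * x) * (f' x + c * f x)"]) auto
  qed (intro continuous_intros assms)
  moreover have "0 \<le> exp (c * a) * f a" using assms(3) by simp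
  ultimately have "0 \<le> exp (c * b) * f b" by linarith
  then show ?thesis by (simp add: zero_le_mult_iff)
qed

text \<open>The first-order lemma is applied twice: rate 1 gives \<open>f' \<ge> 0\<close>, then
  rate 0 gives \<open>f \<ge> 0\<close>. This is the comparison principle behind every bound on
  \<open>green\<close>.\<close>

lemma nonneg_of_second_order_nonneg:
  fixes f f' f'' :: "real \<Rightarrow> real"
  assumes "f 0 = 0" "f' 0 = 0" "continuous_on {0..} f" "continuous_on {0..} f'"
    and "\<And>x. 0 < x \<Longrightarrow> (f has_real_derivative f' x) (at x)"
    and "\<And>x. 0 < x \<Longrightarrow> (f' has_real_derivative f'' x) (at x)"
    and "\<And>x. 0 < x \<Longrightarrow> 0 \<le> f'' x + f' x"
    and "0 \<le> y"
  shows "0 \<le> f y"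
proof -
  have "0 \<le> f' x" if "0 \<le> x" for x
    by (rule nonneg_of_linear_deriv_nonneg[OF that, of f' f'' 1])
      (use assms in \<open>auto intro: continuous_on_subset\<close>)
  then show ?thesis
    by (intro nonneg_of_linear_deriv_nonneg[OF \<open>0 \<le> y\<close>, of f f' 0])
      (use assms in \<open>auto intro: continuous_on_subset\<close>)
qed

text \<open>The solution of \<open>F' + c F = f\<close> that vanishes on the negative half-line, for \<open>f\<close> vanishing there.\<close>

definition relax :: "real \<Rightarrow> (real \<Rightarrow> real) \<Rightarrow> real \<Rightarrow> real" where
  "relax c f x = exp (- c * x) * integral {0..x} (\<lambda>s. exp (c * s) * f s)"

text \<open>Since \<open>f\<close> vanishes to the left of 0, the lower limit 0 may be replaced by a
  fixed point left of both 0 and \<open>x\<close>. The fundamental theorem then gives a two-sided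
  derivative, also at \<open>x \<le> 0\<close>.\<close>

lemma integral_from_zero_deriv:
  fixes f :: "real \<Rightarrow> real"
  assumes "continuous_on UNIV f" "\<And>x. x \<le> 0 \<Longrightarrow> f x = 0"
  shows "((\<lambda>x. integral {0..x} f) has_real_derivative f x) (at x)"
proof -
  define a where "a = - \<bar>x\<bar> - 1"
  define b where "b = \<bar>x\<bar> + 1"
  have cont: "continuous_on S f" for S using assms(1) continuous_on_subset by blast
  have "((\<lambda>x. integral {a..x} f) has_real_derivative f x) (at x within {a..b})"
    by (rule integral_has_real_derivative[OF cont]) (auto simp: a_def b_def)
  then have *: "((\<lambda>x. integral {a..x} f) has_real_derivative f x) (at x)"
    by (subst (asm) at_within_interior) (auto simp: a_def b_def)
  have eq: "integral {a..y} f = integral {0..y} f" if "a \<le> y" for y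
  proof (cases "0 \<le> y")
    case True
    have "integral {a..0} f + integral {0..y} f = integral {a..y} f"
      using True by (intro Henstock_Kurzweil_Integration.integral_combine)
         (auto simp: a_def intro!: integrable_continuous_real cont)
    moreover have "integral {a..0} f = integral {a..0} (\<lambda>_. 0)"
      by (rule integral_cong) (use assms(2) in auto)
    ultimately show ?thesis by simp
  next
    case False
    have "integral {a..y} f = integral {a..y} (\<lambda>_. 0)"
      by (rule integral_cong) (use assms(2) False in auto)
    then show ?thesis using False by simp
  qed
  have "a \<le> y" if "dist y x < 1" for y
    using that by (auto simp: a_def dist_real_def)
  then show ?thesis
    by (intro has_field_derivative_transform_within[OF *, of 1]) (auto intro!: eq)
qed

lemma relax_nonpos [simp]: "x \<le> 0 \<Longrightarrow> relax c f x = 0"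
  by (cases "x = 0") (auto simp: relax_def)

lemma relax_deriv:
  fixes f :: "real \<Rightarrow> real"
  assumes "continuous_on UNIV f" "\<And>x. x \<le> 0 \<Longrightarrow> f x = 0"
  shows "(relax c f has_real_derivative f x - c * relax c f x) (at x)"
proof -
  have *: "((\<lambda>x. integral {0..x} (\<lambda>s. exp (c * s) * f s)) has_real_derivative exp (c * x) * f x) (at x)"
    by (rule integral_from_zero_deriv)
       (auto intro!: continuous_intros assms)
  have "((\<lambda>x. exp (- c * x) * integral {0..x} (\<lambda>s. exp (c * s) * f s)) has_real_derivative
     f x - c * relax c f x) (at x)"
    unfolding relax_def
    by (rule derivative_eq_intros * refl | simp add: algebra_simps exp_minus)+
  then show ?thesis
    by (simp add: relax_def[abs_def])
qed

subsection \<open>Existence of the profile\<close>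

lemma relax_continuous:
  assumes "continuous_on UNIV f" "\<And>x. x \<le> 0 \<Longrightarrow> f x = 0"
  shows "continuous_on S (relax c f)"
  using relax_deriv[OF assms] by (meson DERIV_atLeastAtMost_imp_continuous_on DERIV_isCont continuous_at_imp_continuous_on)

text \<open>Green operator of \<open>F'' + F' = f\<close> with zero data at 0, obtained from the
  factorization \<open>(D + 1) D\<close>: first integrate, then invert \<open>D + 1\<close>.\<close>

definition green :: "(real \<Rightarrow> real) \<Rightarrow> real \<Rightarrow> real" where
  "green f = relax 1 (relax 0 f)"

definition green' :: "(real \<Rightarrow> real) \<Rightarrow> real \<Rightarrow> real" where
  "green' f x = relax 0 f x - green f x"

lemma green_nonpos [simp]: "x \<le> 0 \<Longrightarrow> green f x = 0" "x \<le> 0 \<Longrightarrow> green' f x = 0"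
  by (auto simp: green_def green'_def)

lemma green_deriv:
  assumes "continuous_on UNIV f" "\<And>x. x \<le> 0 \<Longrightarrow> f x = 0"
  shows "(green f has_real_derivative green' f x) (at x)"
    and "(green' f has_real_derivative f x - green' f x) (at x)"
proof -
  note c = relax_continuous[OF assms]
  show 1: "(green f has_real_derivative green' f x) (at x)" for x
    using relax_deriv[where f="relax 0 f" and c=1, OF c relax_nonpos] by (simp add: green'_def green_def)
  show "(green' f has_real_derivative f x - green' f x) (at x)"
    unfolding green'_def[abs_def]
    using DERIV_diff[OF relax_deriv[where c=0, OF assms] 1] by (simp add: green'_def)
qed

lemma green_continuous:
  assumes "continuous_on UNIV f" "\<And>x. x \<le> 0 \<Longrightarrow> f x = 0"
  shows "continuous_on S (green f)" "continuous_on S (green' f)"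
  using green_deriv[OF assms] by (meson DERIV_isCont continuous_at_imp_continuous_on)+

text \<open>The comparison principle applied to \<open>l * green g - green f\<close>. Carrying the
  factor \<open>l\<close> combines monotonicity with homogeneity, as the contraction estimate
  requires.\<close>

lemma green_mono:
  assumes f: "continuous_on UNIV f" "\<And>x. x \<le> 0 \<Longrightarrow> f x = 0"
    and g: "continuous_on UNIV g" "\<And>x. x \<le> 0 \<Longrightarrow> g x = 0"
    and le: "\<And>x. 0 < x \<Longrightarrow> f x \<le> l * g x" and y: "0 \<le> y"
  shows "green f y \<le> l * green g y"
proof -
  have "0 \<le> l * green g y - green f y"
    by (rule nonneg_of_second_order_nonneg[where f="\<lambda>y. l * green g y - green f y"
        and f'="\<lambda>y. l * green' g y - green' f y"
        and f''="\<lambda>y. l * (g y - green' g y) - (f y - green' f y)"])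
      (use le y in \<open>auto intro!: continuous_intros green_continuous f g derivative_eq_intros green_deriv
          simp: algebra_simps\<close>)
  then show ?thesis by simp
qed

text \<open>The solution of \<open>B'' + B' = 1\<close> with zero data at 0. It behaves like
  \<open>y^2 / 2\<close> near 0 and like \<open>y\<close> at infinity, so one power of it has the
  growth of the profile at both ends.\<close>

definition base :: "real \<Rightarrow> real" where "base y = y - 1 + exp (- y)"

lemma base_0 [simp]: "base 0 = 0" by (simp add: base_def)

lemma base_ge: "y - 1 \<le> base y" by (simp add: base_def)

lemma base_nonneg: "0 \<le> base y"
  using exp_ge_add_one_self[of "-y"] by (simp add: base_def)

lemma base_pos: "0 < y \<Longrightarrow> 0 < base y"
  using exp_minus_greater[of y] by (auto simp: base_def)

lemma base_deriv [derivative_intros]: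
  "(f has_real_derivative f') (at x) \<Longrightarrow>
   ((\<lambda>x. base (f x)) has_real_derivative (1 - exp (- f x)) * f') (at x)"
  unfolding base_def by (rule derivative_eq_intros refl | assumption | simp add: algebra_simps)+

lemma base_continuous [continuous_intros]:
  "continuous_on S f \<Longrightarrow> continuous_on S (\<lambda>x. base (f x))"
  unfolding base_def by (intro continuous_intros)

text \<open>The difference of the two sides has derivative \<open>2 * (1 - exp (- y))^2\<close>. The
  bound absorbs the squared first derivative that arises when a power of \<open>base\<close> is
  differentiated twice.\<close>

lemma base_deriv_square_le:
  assumes "0 \<le> y"
  shows "(1 - exp (- y))\<^sup>2 \<le> 2 * base y"
proof -
  have "0 \<le> 2 * base y - (1 - exp (- y))\<^sup>2"
    by (rule nonneg_of_linear_deriv_nonneg[OF assms,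
          of _ "\<lambda>y. 2 * (1 - exp (- y)) - 2 * (1 - exp (- y)) * exp (- y)" 0])
       (auto intro!: continuous_intros derivative_eq_intros simp: mult_le_cancel_left1 power2_eq_square)
  then show ?thesis by simp
qed

section \<open>Comparison of the Green operator with a power of \<open>base\<close>\<close>

locale sublinear =
  fixes \<alpha> :: real
  assumes alpha_pos: "0 < \<alpha>" and alpha_less_1: "\<alpha> < 1"
begin

text \<open>The exponent that balances the equation: the \<alpha>-th power of
  \<open>base powr \<beta>\<close> is \<open>base powr (\<beta> - 1)\<close>, the order of its image
  under \<open>D^2 + D\<close>.\<close>

definition \<beta> :: real where "\<beta> = 1 / (1 - \<alpha>)"

lemma beta: "1 < \<beta>" "\<alpha> * \<beta> = \<beta> - 1"
  using alpha_pos alpha_less_1 by (auto simp: \<beta>_def field_simps)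

lemma two_beta_square: "0 < 2 * \<beta>\<^sup>2 - \<beta>"
proof -
  have "0 < \<beta> * (2 * \<beta> - 1)" using beta(1) by simp
  then show ?thesis by (simp add: algebra_simps power2_eq_square)
qed

definition weight :: "real \<Rightarrow> real" where "weight y = base y powr \<beta>"

definition weight' :: "real \<Rightarrow> real" where
  "weight' y = \<beta> * base y powr (\<beta> - 1) * (1 - exp (- y))"

definition weight'' :: "real \<Rightarrow> real" where
  "weight'' y = \<beta> * (\<beta> - 1) * base y powr (\<beta> - 2) * (1 - exp (- y))\<^sup>2
     + \<beta> * base y powr (\<beta> - 1) * exp (- y)"

lemma weight_0 [simp]: "weight 0 = 0" "weight' 0 = 0"
  by (auto simp: weight_def weight'_def)

lemma weight_pos: "0 < y \<Longrightarrow> 0 < weight y"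
  using base_pos[of y] by (simp add: weight_def)

lemma weight_continuous: "continuous_on S weight" "continuous_on S weight'"
  unfolding weight_def[abs_def] weight'_def[abs_def] using beta base_nonneg
  by (auto intro!: continuous_intros continuous_on_powr')

lemma weight_deriv:
  assumes "0 < y"
  shows "(weight has_real_derivative weight' y) (at y)"
    and "(weight' has_real_derivative weight'' y) (at y)"
proof -
  have b: "(base has_real_derivative 1 - exp (- y)) (at y)"
    by (rule derivative_eq_intros refl | simp)+
  note p = DERIV_fun_powr[OF b base_pos[OF assms]]
  show "(weight has_real_derivative weight' y) (at y)"
    unfolding weight_def[abs_def] weight'_def using p[of \<beta>] by simp
  show "(weight' has_real_derivative weight'' y) (at y)"
    unfolding weight'_def[abs_def] weight''_def
    by (rule derivative_eq_intros p refl | simp add: algebra_simps power2_eq_square)+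
qed

text \<open>As \<open>base'' + base' = 1\<close>, the sum is
  \<open>\<beta> * base powr (\<beta> - 1)\<close> plus a nonnegative multiple of
  \<open>base'^2\<close>. By \<open>base_deriv_square_le\<close> the extra term is at most
  \<open>2 * \<beta> * (\<beta> - 1) * base powr (\<beta> - 1)\<close>, and \<open>\<beta> + 2 *
  \<beta> * (\<beta> - 1) = 2 * \<beta>^2 - \<beta>\<close>.\<close>

lemma weight_second_order:
  assumes "0 < y"
  shows "\<beta> * base y powr (\<beta> - 1) \<le> weight'' y + weight' y"
    and "weight'' y + weight' y \<le> (2 * \<beta>\<^sup>2 - \<beta>) * base y powr (\<beta> - 1)"
proof -
  have eq: "weight'' y + weight' y =
      \<beta> * base y powr (\<beta> - 1) + \<beta> * (\<beta> - 1) * (base y powr (\<beta> - 2) * (1 - exp (- y))\<^sup>2)"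
    by (simp add: weight''_def weight'_def algebra_simps)
  show "\<beta> * base y powr (\<beta> - 1) \<le> weight'' y + weight' y"
    unfolding eq using beta by simp
  have "base y powr (\<beta> - 2) * (1 - exp (- y))\<^sup>2 \<le> base y powr (\<beta> - 2) * (2 * base y)"
    using base_deriv_square_le[of y] assms by (intro mult_left_mono) auto
  also have "\<dots> = 2 * base y powr (\<beta> - 1)"
    using base_pos[OF assms] by (simp add: powr_mult_base algebra_simps)
  finally have "\<beta> * (\<beta> - 1) * (base y powr (\<beta> - 2) * (1 - exp (- y))\<^sup>2)
      \<le> \<beta> * (\<beta> - 1) * (2 * base y powr (\<beta> - 1))"
    using beta by (intro mult_left_mono) auto
  then show "weight'' y + weight' y \<le> (2 * \<beta>\<^sup>2 - \<beta>) * base y powr (\<beta> - 1)"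
    unfolding eq by (simp add: algebra_simps power2_eq_square)
qed

text \<open>By the lower bound in \<open>weight_second_order\<close>, \<open>C * weight\<close> is a
  supersolution for the source \<open>f\<close>. The companion \<open>green_ge_weight\<close> uses
  the upper bound to make it a subsolution.\<close>

lemma green_le_weight:
  assumes f: "continuous_on UNIV f" "\<And>x. x \<le> 0 \<Longrightarrow> f x = 0"
    and le: "\<And>x. 0 < x \<Longrightarrow> f x \<le> C * \<beta> * base x powr (\<beta> - 1)" and "0 \<le> C" "0 \<le> y"
  shows "green f y \<le> C * weight y"
proof -
  have *: "0 \<le> C * (weight'' x + weight' x) - f x" if "0 < x" for x
    using mult_left_mono[OF weight_second_order(1)[OF that] \<open>0 \<le> C\<close>] le[OF that] by simp
  have "0 \<le> C * weight y - green f y"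
  proof (rule nonneg_of_second_order_nonneg[where f="\<lambda>y. C * weight y - green f y" and f'="\<lambda>y. C * weight' y - green' f y"
        and f''="\<lambda>y. C * weight'' y - (f y - green' f y)"])
    fix x :: real assume x: "0 < x"
    show "((\<lambda>y. C * weight y - green f y) has_real_derivative C * weight' x - green' f x) (at x)"
      by (intro derivative_intros green_deriv f weight_deriv x DERIV_cmult)
    show "((\<lambda>y. C * weight' y - green' f y) has_real_derivative C * weight'' x - (f x - green' f x)) (at x)"
      by (intro derivative_intros green_deriv f weight_deriv x DERIV_cmult)
    show "0 \<le> C * weight'' x - (f x - green' f x) + (C * weight' x - green' f x)"
      using *[OF x] by (simp add: algebra_simps)
  qed (use \<open>0 \<le> y\<close> in \<open>auto intro!: continuous_intros green_continuous weight_continuous f\<close>)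
  then show ?thesis by simp
qed

lemma green_ge_weight:
  assumes f: "continuous_on UNIV f" "\<And>x. x \<le> 0 \<Longrightarrow> f x = 0"
    and le: "\<And>x. 0 < x \<Longrightarrow> C * (2 * \<beta>\<^sup>2 - \<beta>) * base x powr (\<beta> - 1) \<le> f x" and "0 \<le> C" "0 \<le> y"
  shows "C * weight y \<le> green f y"
proof -
  have *: "0 \<le> f x - C * (weight'' x + weight' x)" if "0 < x" for x
    using mult_left_mono[OF weight_second_order(2)[OF that] \<open>0 \<le> C\<close>] le[OF that] by simp
  have "0 \<le> green f y - C * weight y"
  proof (rule nonneg_of_second_order_nonneg[where f="\<lambda>y. green f y - C * weight y" and f'="\<lambda>y. green' f y - C * weight' y"
        and f''="\<lambda>y. (f y - green' f y) - C * weight'' y"])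
    fix x :: real assume x: "0 < x"
    show "((\<lambda>y. green f y - C * weight y) has_real_derivative green' f x - C * weight' x) (at x)"
      by (intro derivative_intros green_deriv f weight_deriv x DERIV_cmult)
    show "((\<lambda>y. green' f y - C * weight' y) has_real_derivative (f x - green' f x) - C * weight'' x) (at x)"
      by (intro derivative_intros green_deriv f weight_deriv x DERIV_cmult)
    show "0 \<le> (f x - green' f x) - C * weight'' x + (green' f x - C * weight' x)"
      using *[OF x] by (simp add: algebra_simps)
  qed (use \<open>0 \<le> y\<close> in \<open>auto intro!: continuous_intros green_continuous weight_continuous f\<close>)
  then show ?thesis by simp
qed

text \<open>
  A positive function \<open>W\<close> on \<open>(0,\<infinity>)\<close> is written as \<open>W y = weight y * exp (\<phi> (ln y))\<close>, so that \<open>\<phi>\<close> ranges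
  over bounded continuous functions on the whole line and no limit at \<open>y = 0\<close> is needed. Then
  \<open>source \<phi>\<close> is \<open>W powr \<alpha>\<close>, as \<open>\<alpha> * \<beta> = \<beta> - 1\<close>.
\<close>

definition source :: "(real \<Rightarrow>\<^sub>C real) \<Rightarrow> real \<Rightarrow> real" where
  "source \<phi> y = (if y \<le> 0 then 0 else base y powr (\<beta> - 1) * exp (\<alpha> * \<phi> (ln y)))"

lemma source_nonpos [simp]: "y \<le> 0 \<Longrightarrow> source \<phi> y = 0"
  by (simp add: source_def)

lemma bcontfun_bound:
  fixes \<phi> :: "real \<Rightarrow>\<^sub>C real"
  obtains B where "\<And>t. \<bar>\<phi> t\<bar> \<le> B"
  using bounded_apply_bcontfun[of \<phi>] by (auto simp: bounded_iff)

text \<open>The delicate point is 0, where \<open>\<phi> (ln y)\<close> may oscillate. Boundedness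
  of \<phi> squeezes \<open>source \<phi>\<close> below a multiple of
  \<open>base powr (\<beta> - 1)\<close>, which tends to 0 because
  \<open>\<beta> > 1\<close>.\<close>

lemma source_continuous: "continuous_on UNIV (source \<phi>)"
proof -
  obtain B where B: "\<And>t. \<bar>\<phi> t\<bar> \<le> B" using bcontfun_bound by blast
  have "isCont (source \<phi>) y" for y
  proof (cases y "0 :: real" rule: linorder_cases)
    case less
    have "isCont (source \<phi>) y \<longleftrightarrow> isCont (\<lambda>_. 0 :: real) y"
      using less by (intro isCont_cong eventually_nhds_in_open[of "{..<0}", THEN eventually_mono]) auto
    then show ?thesis by simp
  next
    case greater
    have "isCont (source \<phi>) y \<longleftrightarrow> isCont (\<lambda>y. base y powr (\<beta> - 1) * exp (\<alpha> * \<phi> (ln y))) y"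
      using greater by (intro isCont_cong eventually_nhds_in_open[of "{0<..}", THEN eventually_mono])
         (auto simp: source_def)
    moreover have "continuous_on {0<..} (\<lambda>y. base y powr (\<beta> - 1) * exp (\<alpha> * \<phi> (ln y)))"
      by (intro continuous_intros continuous_on_compose2[OF continuous_on_apply_bcontfun[of UNIV \<phi>]])
         (auto dest: base_pos)
    ultimately show ?thesis using greater by (simp add: continuous_on_eq_continuous_at)
  next
    case equal
    have "continuous_on UNIV (\<lambda>y. base y powr (\<beta> - 1) * exp (\<alpha> * B))"
      using beta base_nonneg by (auto intro!: continuous_intros continuous_on_powr')
    then have "(\<lambda>y. base y powr (\<beta> - 1) * exp (\<alpha> * B)) \<midarrow>0\<rightarrow> 0"
      by (subst (asm) continuous_on_eq_continuous_at) (auto simp: isCont_def dest!: spec[of _ 0] intro: tendsto_mult_left_zero)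
    then have "source \<phi> \<midarrow>0\<rightarrow> 0"
    proof (rule Lim_null_comparison[rotated], intro always_eventually allI)
      fix y
      show "norm (source \<phi> y) \<le> base y powr (\<beta> - 1) * exp (\<alpha> * B)"
        using B[of "ln y"] alpha_pos by (auto simp: source_def abs_le_iff intro!: mult_left_mono)
    qed
    then show ?thesis using equal by (simp add: isCont_def)
  qed
  then show ?thesis by (simp add: continuous_at_imp_continuous_on)
qed

text \<open>A bound on \<phi> pins the source between two multiples of
  \<open>base powr (\<beta> - 1)\<close>. Hence the logarithm of the ratio to \<open>weight\<close>
  stays bounded, which makes \<open>step\<close> a self-map of the bounded continuous
  functions.\<close>

lemma green_source_bounds:
  fixes \<phi> :: "real \<Rightarrow>\<^sub>C real"
  assumes "\<And>t. \<bar>\<phi> t\<bar> \<le> B" "0 \<le> y"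
  shows "exp (- \<alpha> * B) / (2 * \<beta>\<^sup>2 - \<beta>) * weight y \<le> green (source \<phi>) y"
    and "green (source \<phi>) y \<le> exp (\<alpha> * B) / \<beta> * weight y"
proof -
  note pos = two_beta_square
  have le: "exp (- \<alpha> * B) \<le> exp (\<alpha> * \<phi> t)" "exp (\<alpha> * \<phi> t) \<le> exp (\<alpha> * B)" for t
    using mult_left_mono[of "- B" "\<phi> t" \<alpha>] mult_left_mono[of "\<phi> t" B \<alpha>] assms(1)[of t] alpha_pos
    by (auto simp: abs_le_iff)
  then have le: "exp (- \<alpha> * B) * z \<le> z * exp (\<alpha> * \<phi> t)" "z * exp (\<alpha> * \<phi> t) \<le> exp (\<alpha> * B) * z"
    if "0 \<le> z" for t z
    unfolding mult.commute[of "exp _"] by (intro mult_left_mono le that)+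
  show "exp (- \<alpha> * B) / (2 * \<beta>\<^sup>2 - \<beta>) * weight y \<le> green (source \<phi>) y"
    by (rule green_ge_weight[OF source_continuous]) (use pos le assms in \<open>auto simp: source_def\<close>)
  show "green (source \<phi>) y \<le> exp (\<alpha> * B) / \<beta> * weight y"
    by (rule green_le_weight[OF source_continuous]) (use beta le assms in \<open>auto simp: source_def\<close>)
qed

section \<open>The fixed-point map in logarithmic variables\<close>

lemma green_source_pos: "0 < y \<Longrightarrow> 0 < green (source \<phi>) y"
proof -
  assume y: "0 < y"
  obtain B where B: "\<And>t. \<bar>\<phi> t\<bar> \<le> B" using bcontfun_bound by blast
  have "0 < exp (- \<alpha> * B) / (2 * \<beta>\<^sup>2 - \<beta>) * weight y" using weight_pos[OF y] two_beta_square by simp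
  then show ?thesis using green_source_bounds(1)[OF B, of y] y by linarith
qed

text \<open>The map taking \<open>W\<close> to \<open>green (W powr \<alpha>)\<close>, expressed
  through the logarithm of the ratio to \<open>weight\<close>. That the argument of
  \<open>Bcontfun\<close> is bounded and continuous is proved in \<open>step_apply\<close>.\<close>

definition step :: "(real \<Rightarrow>\<^sub>C real) \<Rightarrow> (real \<Rightarrow>\<^sub>C real)" where
  "step \<phi> = Bcontfun (\<lambda>t. ln (green (source \<phi>) (exp t) / weight (exp t)))"

lemma step_apply: "step \<phi> t = ln (green (source \<phi>) (exp t) / weight (exp t))"
proof -
  obtain B where B: "\<And>t. \<bar>\<phi> t\<bar> \<le> B" using bcontfun_bound by blast
  note pos = two_beta_square
  have "(\<lambda>t. ln (green (source \<phi>) (exp t) / weight (exp t))) \<in> bcontfun"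
    unfolding bcontfun_def
  proof (intro CollectI conjI)
    show "continuous_on UNIV (\<lambda>t. ln (green (source \<phi>) (exp t) / weight (exp t)))"
      using green_source_pos[of "exp _"] weight_pos[of "exp _"]
      by (intro continuous_intros continuous_on_compose2[OF green_continuous(1)[of "source \<phi>" UNIV]]
           continuous_on_compose2[OF weight_continuous(1)[of UNIV]] source_continuous)
         (auto simp: less_le)
    have "\<bar>ln (green (source \<phi>) (exp t) / weight (exp t))\<bar>
        \<le> \<bar>ln (exp (- \<alpha> * B) / (2 * \<beta>\<^sup>2 - \<beta>))\<bar> + \<bar>ln (exp (\<alpha> * B) / \<beta>)\<bar>" for t
    proof -
      define q where "q = green (source \<phi>) (exp t) / weight (exp t)"
      have "0 < exp (- \<alpha> * B) / (2 * \<beta>\<^sup>2 - \<beta>)" using pos by simp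
      moreover have "exp (- \<alpha> * B) / (2 * \<beta>\<^sup>2 - \<beta>) \<le> q" "q \<le> exp (\<alpha> * B) / \<beta>"
        using green_source_bounds[OF B, of "exp t"] weight_pos[of "exp t"]
        unfolding q_def by (auto simp: pos_le_divide_eq pos_divide_le_eq)
      ultimately have "ln (exp (- \<alpha> * B) / (2 * \<beta>\<^sup>2 - \<beta>)) \<le> ln q" "ln q \<le> ln (exp (\<alpha> * B) / \<beta>)"
        by (auto intro: ln_mono)
      then show ?thesis unfolding q_def[symmetric] by linarith
    qed
    then show "bounded (range (\<lambda>t. ln (green (source \<phi>) (exp t) / weight (exp t))))"
      by (intro boundedI) auto
  qed
  then show ?thesis by (simp add: step_def Bcontfun_inverse)
qed

text \<open>The power \<alpha> shrinks the logarithmic distance by the factor \<alpha>, and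
  \<open>green_mono\<close> passes the resulting multiplicative constant through the Green operator.
  Exchanging the two functions gives the absolute value.\<close>

lemma step_contraction: "dist (step \<phi>) (step \<psi>) \<le> \<alpha> * dist \<phi> \<psi>"
proof -
  have le: "step \<phi> t - step \<psi> t \<le> \<alpha> * dist \<phi> \<psi>" for \<phi> \<psi> t
  proof -
    have "source \<phi> y \<le> exp (\<alpha> * dist \<phi> \<psi>) * source \<psi> y" if "0 < y" for y
    proof -
      have "\<phi> (ln y) \<le> dist \<phi> \<psi> + \<psi> (ln y)"
        using dist_bounded[of \<phi> "ln y" \<psi>] by (simp add: dist_real_def)
      then have "\<alpha> * \<phi> (ln y) \<le> \<alpha> * dist \<phi> \<psi> + \<alpha> * \<psi> (ln y)"
        using alpha_pos by (metis distrib_left mult_le_cancel_left_pos)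
      then have "exp (\<alpha> * \<phi> (ln y)) \<le> exp (\<alpha> * dist \<phi> \<psi>) * exp (\<alpha> * \<psi> (ln y))"
        by (simp flip: exp_add)
      from mult_left_mono[OF this, of "base y powr (\<beta> - 1)"]
      show ?thesis using that by (simp add: source_def mult_ac)
    qed
    then have "green (source \<phi>) (exp t) \<le> exp (\<alpha> * dist \<phi> \<psi>) * green (source \<psi>) (exp t)"
      by (intro green_mono source_continuous) auto
    then have "ln (green (source \<phi>) (exp t)) \<le> ln (exp (\<alpha> * dist \<phi> \<psi>) * green (source \<psi>) (exp t))"
      using green_source_pos[of "exp t"] by (intro ln_mono) auto
    then show ?thesis
      using green_source_pos[of "exp t" \<phi>] green_source_pos[of "exp t" \<psi>] weight_pos[of "exp t"]
      by (simp add: step_apply ln_div ln_mult)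
  qed
  show ?thesis
  proof (rule dist_bound)
    fix t
    show "dist (step \<phi> t) (step \<psi> t) \<le> \<alpha> * dist \<phi> \<psi>"
      using le[of \<phi> t \<psi>] le[of \<psi> t \<phi>] by (simp add: dist_real_def abs_le_iff dist_commute)
  qed
qed

text \<open>The fixed point of \<open>step\<close> yields
  \<open>W = green (W powr \<alpha>)\<close>. Extension by zero to the left makes both derivatives
  two-sided at 0 as well.\<close>

theorem profile_exists:
  obtains W W' :: "real \<Rightarrow> real"
  where "\<And>x. x \<le> 0 \<Longrightarrow> W x = 0" "\<And>x. x \<le> 0 \<Longrightarrow> W' x = 0" "\<And>x. 0 < x \<Longrightarrow> 0 < W x"
    and "\<And>x. (W has_real_derivative W' x) (at x)"
    and "\<And>x. (W' has_real_derivative W x powr \<alpha> - W' x) (at x)"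
    and "filterlim W at_top at_top"
proof -
  have "\<exists>!\<phi>. step \<phi> = \<phi>"
    by (rule banach_fix_type[of \<alpha>]) (use alpha_pos alpha_less_1 step_contraction in auto)
  then obtain \<phi> where fp: "step \<phi> = \<phi>" by blast
  have W: "green (source \<phi>) y = weight y * exp (\<phi> (ln y))" if "0 < y" for y
    using step_apply[of \<phi> "ln y"] green_source_pos[of y \<phi>] weight_pos[of y] that unfolding fp
    by simp
  have src: "source \<phi> y = green (source \<phi>) y powr \<alpha>" for y
  proof (cases "y \<le> 0")
    case False
    then show ?thesis using beta(2)
      by (simp add: W source_def weight_def powr_mult powr_powr exp_powr_real mult_ac)
  qed simp
  obtain B where B: "\<And>t. \<bar>\<phi> t\<bar> \<le> B" using bcontfun_bound by blast
  have lim: "filterlim (green (source \<phi>)) at_top at_top"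
  proof (rule filterlim_at_top_mono)
    show "filterlim (\<lambda>y. exp (- B) * (- 1 + y)) at_top at_top"
      by (intro filterlim_tendsto_pos_mult_at_top[OF tendsto_const]
          filterlim_tendsto_add_at_top[OF tendsto_const] filterlim_ident) simp
    \<comment> \<open>From \<open>y = 2\<close> on, \<open>base y \<ge> 1\<close>, so raising it to
      the power \<open>\<beta> > 1\<close> only increases it.\<close>
    show "\<forall>\<^sub>F y in at_top. exp (- B) * (- 1 + y) \<le> green (source \<phi>) y"
      using eventually_ge_at_top[of 2]
    proof eventually_elim
      case (elim y)
      have "y - 1 \<le> base y" by (rule base_ge)
      also have "\<dots> = base y powr 1" using base_nonneg[of y] by simp
      also have "\<dots> \<le> base y powr \<beta>"
        using beta elim base_ge[of y] by (intro powr_mono) auto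
      finally have "y - 1 \<le> weight y" by (simp add: weight_def)
      then show ?case
        unfolding W[OF less_le_trans[OF zero_less_numeral elim]]
        using B[of "ln y"] elim by (subst mult.commute) (intro mult_mono, auto simp: abs_le_iff)
    qed
  qed
  show thesis
    by (rule that[of "green (source \<phi>)" "green' (source \<phi>)"])
      (use green_deriv[OF source_continuous source_nonpos, of \<phi>] lim green_source_pos
        in \<open>simp_all add: src[symmetric]\<close>)
qed

subsection \<open>Uniqueness of the profile\<close>

text \<open>Stated on a finite interval with derivatives in its interior, which is what a rescaled
  \<open>v\<close> on \<open>[-R,0]\<close> provides.\<close>

definition profile_on :: "real \<Rightarrow> (real \<Rightarrow> real) \<Rightarrow> (real \<Rightarrow> real) \<Rightarrow> bool" where
  "profile_on S V V' \<longleftrightarrow>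
     V 0 = 0 \<and> V' 0 = 0 \<and> continuous_on {0..S} V \<and> continuous_on {0..S} V' \<and>
     (\<forall>x\<in>{0<..<S}. 0 < V x \<and> (V has_real_derivative V' x) (at x) \<and>
        (V' has_real_derivative V x powr \<alpha> - V' x) (at x))"

lemma profile_on_deriv_pos:
  assumes "profile_on S V V'" "0 < x" "x < S"
  shows "0 < V' x"
proof (rule pos_of_linear_deriv_pos[OF \<open>0 < x\<close>, of V' "\<lambda>x. V x powr \<alpha> - V' x" 1])
  show "continuous_on {0..x} V'"
    using assms by (auto simp: profile_on_def intro: continuous_on_subset)
  fix t assume "0 < t" "t < x"
  then have "0 < V t" using assms by (auto simp: profile_on_def)
  then show "0 < V t powr \<alpha> - V' t + 1 * V' t" by simp
qed (use assms in \<open>auto simp: profile_on_def\<close>)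

text \<open>Translating \<open>W\<close> to the right by \<open>e\<close> gives \<open>V\<close> a
  strict head start in value and slope at \<open>e\<close>, away from the non-Lipschitz point. Up to
  a first contact the power is larger for \<open>V\<close>, so the difference has positive slope and
  contact cannot occur.\<close>

lemma profile_on_shift_less:
  assumes V: "profile_on S V V'" and W: "profile_on S W W'"
    and e: "0 < e" and y: "e \<le> y" "y < S"
  shows "W (y - e) < V y"
proof (rule ccontr)
  define d where "d x = V x - W (x - e)" for x
  define d' where "d' x = V' x - W' (x - e)" for x
  have "(\<lambda>x. x - e) ` {e..y} \<subseteq> {0..S}" using e y by auto
  then have cont: "continuous_on {e..z} d" "continuous_on {e..z} d'" if "z \<le> y" for z
    unfolding d_def d'_def using V W e y that
    by (auto simp: profile_on_def intro!: continuous_intros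
        intro: continuous_on_subset continuous_on_compose2[where f="\<lambda>x. x - e"])
  assume "\<not> W (y - e) < V y"
  define Z where "Z = {e..y} \<inter> d -` {..0}"
  have "y \<in> Z" using y \<open>\<not> W (y - e) < V y\<close> by (auto simp: Z_def d_def)
  have bdd: "bdd_below Z" by (auto simp: Z_def)
  have "closed Z"
    unfolding Z_def by (rule continuous_closed_preimage) (auto intro: cont)
  \<comment> \<open>The first point where the translate reaches \<open>V\<close>; \<open>Z\<close>
    is closed, so the infimum belongs to it.\<close>
  define z where "z = Inf Z"
  have "z \<in> Z" unfolding z_def by (rule closed_contains_Inf) (use \<open>y \<in> Z\<close> bdd \<open>closed Z\<close> in auto)
  then have z: "e \<le> z" "z \<le> y" "d z \<le> 0" by (auto simp: Z_def)
  have pos: "0 < d x" if "e \<le> x" "x < z" for x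
  proof (rule ccontr)
    assume "\<not> 0 < d x"
    then have "x \<in> Z" using that z by (auto simp: Z_def)
    then have "z \<le> x" unfolding z_def using bdd by (rule cInf_lower)
    then show False using that by simp
  qed
  have de: "0 < d e" "0 < d' e"
    using V W e y profile_on_deriv_pos[OF V, of e] by (auto simp: d_def d'_def profile_on_def)
  then have "e < z" using z by (cases "e = z") auto
  have in_range: "0 < x \<and> x < S \<and> 0 < x - e \<and> x - e < S" if "e < x" "x < z" for x
    using that e z y by auto
  have 1: "(d has_real_derivative d' x) (at x)" if "e < x" "x < z" for x
  proof -
    have "((\<lambda>x. W (x - e)) has_real_derivative W' (x - e) * 1) (at x)"
      by (rule DERIV_chain2) (use W in_range[OF that] in \<open>auto simp: profile_on_def intro!: derivative_eq_intros\<close>)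
    then show ?thesis
      unfolding d_def d'_def using V in_range[OF that]
      by (auto simp: profile_on_def intro!: derivative_eq_intros)
  qed
  have 2: "(d' has_real_derivative V x powr \<alpha> - W (x - e) powr \<alpha> - d' x) (at x)" if "e < x" "x < z" for x
  proof -
    have "((\<lambda>x. W' (x - e)) has_real_derivative (W (x - e) powr \<alpha> - W' (x - e)) * 1) (at x)"
      by (rule DERIV_chain2) (use W in_range[OF that] in \<open>auto simp: profile_on_def intro!: derivative_eq_intros\<close>)
    then show ?thesis
      unfolding d'_def using V in_range[OF that]
      by (auto simp: profile_on_def intro!: derivative_eq_intros)
  qed
  have d'_pos: "0 < d' x" if "e < x" "x < z" for x
  proof (rule pos_of_linear_deriv_pos[OF \<open>e < x\<close>, of d' "\<lambda>x. V x powr \<alpha> - W (x - e) powr \<alpha> - d' x" 1])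
    show "continuous_on {e..x} d'" by (rule cont) (use that z in auto)
    fix t assume t: "e < t" "t < x"
    show "(d' has_real_derivative V t powr \<alpha> - W (t - e) powr \<alpha> - d' t) (at t)"
      using t that by (intro 2) auto
    have "W (t - e) powr \<alpha> < V t powr \<alpha>"
    proof (rule powr_less_mono2[OF alpha_pos])
      show "0 \<le> W (t - e)" using W in_range[of t] t that by (auto simp: profile_on_def intro: less_imp_le)
      show "W (t - e) < V t" using pos[of t] t that by (simp add: d_def)
    qed
    then show "0 < V t powr \<alpha> - W (t - e) powr \<alpha> - d' t + 1 * d' t" by simp
  qed (use de in simp)
  have "d e < d z"
    by (rule DERIV_pos_imp_increasing_open[OF \<open>e < z\<close>]) (use 1 d'_pos cont z in blast)+
  then show False using z de by simp
qed

text \<open>Let the shift tend to 0. The roles of the two profiles can be exchanged, which gives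
  uniqueness.\<close>

lemma profile_on_le:
  assumes V: "profile_on S V V'" and W: "profile_on S W W'" and "0 < y" "y < S"
  shows "W y \<le> V y"
proof (rule tendsto_upperbound)
  have "isCont W y" using W assms(3,4) by (auto simp: profile_on_def intro: DERIV_isCont)
  moreover have "((\<lambda>e. y - e) \<longlongrightarrow> y) (at_right 0)"
    by (rule tendsto_eq_intros refl | simp)+
  ultimately show "((\<lambda>e. W (y - e)) \<longlongrightarrow> W y) (at_right 0)"
    by (rule isCont_tendsto_compose)
  show "\<forall>\<^sub>F e in at_right 0. W (y - e) \<le> V y"
    using eventually_at_right_less[of 0] eventually_at_right_real[OF \<open>0 < y\<close>]
    by eventually_elim (use profile_on_shift_less[OF V W, of _ y] assms in \<open>auto intro: less_imp_le\<close>)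
qed simp

lemma profile_on_unique:
  assumes V: "profile_on S V V'" and W: "profile_on S W W'" and y: "0 \<le> y" "y \<le> S"
  shows "V y = W y"
proof (cases "0 < S")
  case True
  have "V x - W x = 0" if "x \<in> {0..S}" for x
  proof (rule continuous_constant_on_closure[of "{0<..<S}" "\<lambda>x. V x - W x" 0])
    show "continuous_on (closure {0<..<S}) (\<lambda>x. V x - W x)"
      using V W True by (auto simp: profile_on_def intro!: continuous_intros)
    show "V x - W x = 0" if "x \<in> {0<..<S}" for x
      using profile_on_le[OF V W, of x] profile_on_le[OF W V, of x] that by auto
  qed (use that True in auto)
  then show ?thesis using y by simp
next
  case False
  then have "y = 0" using y by simp
  then show ?thesis using V W by (simp add: profile_on_def)
qed

end

subsection \<open>The ratio \<open>A / G\<close>\<close>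

locale global_profile = sublinear +
  fixes W W' :: "real \<Rightarrow> real" and \<Lambda> :: real
  assumes W_nonpos: "\<And>x. x \<le> 0 \<Longrightarrow> W x = 0" and W'_nonpos: "\<And>x. x \<le> 0 \<Longrightarrow> W' x = 0"
    and W_pos: "\<And>x. 0 < x \<Longrightarrow> 0 < W x"
    and W_deriv: "\<And>x. (W has_real_derivative W' x) (at x)"
    and W'_deriv: "\<And>x. (W' has_real_derivative W x powr \<alpha> - W' x) (at x)"
    and W_at_top: "filterlim W at_top at_top"
    and Lambda_pos: "0 < \<Lambda>"
begin

definition g :: "real \<Rightarrow> real" where "g y = W y powr \<alpha>"
definition g' :: "real \<Rightarrow> real" where "g' y = \<alpha> * g y * W' y / W y"
definition G :: "real \<Rightarrow> real" where "G y = W y + W' y"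
definition A :: "real \<Rightarrow> real" where "A = relax \<Lambda> g"

lemma W_nonneg: "0 \<le> W x"
  using W_pos[of x] W_nonpos[of x] by (cases "0 < x") auto

lemma W_cont: "continuous_on S W" "continuous_on S W'"
  using W_deriv W'_deriv by (meson DERIV_isCont continuous_at_imp_continuous_on)+

lemma g_cont: "continuous_on S g"
  unfolding g_def[abs_def] using alpha_pos W_nonneg
  by (intro continuous_on_powr'[OF W_cont(1) continuous_on_const]) auto

lemma g_nonpos: "x \<le> 0 \<Longrightarrow> g x = 0" by (simp add: g_def W_nonpos)

lemma g_pos: "0 < x \<Longrightarrow> 0 < g x" using W_pos[of x] by (simp add: g_def)

lemma W'_pos:
  assumes "0 < x"
  shows "0 < W' x"
  by (rule pos_of_linear_deriv_pos[OF assms W_cont(2), of "\<lambda>x. W x powr \<alpha> - W' x" 1])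
    (use g_pos in \<open>simp_all add: W'_nonpos W'_deriv g_def\<close>)

lemma g_deriv: "0 < x \<Longrightarrow> (g has_real_derivative g' x) (at x)"
  unfolding g_def[abs_def] g'_def using DERIV_fun_powr[OF W_deriv W_pos, of x \<alpha>] W_pos[of x]
  by (simp add: powr_diff)

lemma G_deriv: "(G has_real_derivative g x) (at x)"
  unfolding G_def[abs_def] g_def using DERIV_add[OF W_deriv W'_deriv, of x] by simp

lemma G_pos: "0 < x \<Longrightarrow> 0 < G x"
  using W_pos[of x] W'_pos[of x] by (simp add: G_def)

lemma G_0 [simp]: "G 0 = 0" by (simp add: G_def W_nonpos W'_nonpos)

lemma G_cont: "continuous_on S G"
  unfolding G_def[abs_def] by (intro continuous_intros W_cont)

lemma A_deriv: "(A has_real_derivative g x - \<Lambda> * A x) (at x)"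
  unfolding A_def by (rule relax_deriv[OF g_cont g_nonpos])

lemma A_0 [simp]: "A 0 = 0" by (simp add: A_def)

lemma A_cont: "continuous_on S A"
  unfolding A_def by (rule relax_continuous[OF g_cont g_nonpos])

text \<open>The function \<open>exp (\<Lambda> * y) * A y - G y\<close> has derivative
  \<open>(exp (\<Lambda> * y) - 1) * g y\<close>. This keeps \<open>A / G\<close> close to 1 for
  small \<open>y\<close>.\<close>

lemma A_ge: "0 \<le> y \<Longrightarrow> exp (- \<Lambda> * y) * G y \<le> A y"
proof -
  assume y: "0 \<le> y"
  have "0 \<le> exp (\<Lambda> * y) * A y - G y"
  proof (rule nonneg_of_linear_deriv_nonneg[OF y, of "\<lambda>y. exp (\<Lambda> * y) * A y - G y"
        "\<lambda>y. (exp (\<Lambda> * y) - 1) * g y" 0])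
    fix x :: real assume "0 < x"
    show "((\<lambda>y. exp (\<Lambda> * y) * A y - G y) has_real_derivative (exp (\<Lambda> * x) - 1) * g x) (at x)"
      by (rule derivative_eq_intros A_deriv G_deriv refl | simp add: algebra_simps)+
    show "0 \<le> (exp (\<Lambda> * x) - 1) * g x + 0 * (exp (\<Lambda> * x) * A x - G x)"
      using g_pos[OF \<open>0 < x\<close>] Lambda_pos \<open>0 < x\<close> by simp
  qed (auto intro!: continuous_intros A_cont G_cont)
  then show ?thesis by (simp add: exp_minus field_simps)
qed

text \<open>The difference \<open>d = g - \<Lambda> * A\<close> satisfies
  \<open>d' + \<Lambda> * d = g'\<close>, and \<open>g\<close> increases. This makes
  \<open>A / G\<close> small wherever \<open>g / G\<close> is small.\<close>

lemma A_le: "0 \<le> y \<Longrightarrow> \<Lambda> * A y \<le> g y"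
proof -
  assume y: "0 \<le> y"
  have "0 \<le> g y - \<Lambda> * A y"
  proof (rule nonneg_of_linear_deriv_nonneg[OF y, of "\<lambda>y. g y - \<Lambda> * A y"
        "\<lambda>y. g' y - \<Lambda> * (g y - \<Lambda> * A y)" \<Lambda>])
    fix x :: real assume x: "0 < x"
    show "((\<lambda>y. g y - \<Lambda> * A y) has_real_derivative g' x - \<Lambda> * (g x - \<Lambda> * A x)) (at x)"
      by (intro derivative_intros DERIV_cmult A_deriv g_deriv x)
    show "0 \<le> g' x - \<Lambda> * (g x - \<Lambda> * A x) + \<Lambda> * (g x - \<Lambda> * A x)"
      using g_pos[OF x] W'_pos[OF x] W_pos[OF x] alpha_pos by (simp add: g'_def)
  qed (auto intro!: continuous_intros A_cont g_cont simp: g_nonpos)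
  then show ?thesis by simp
qed

text \<open>Equivalently, \<open>g / G\<close> is strictly decreasing.\<close>

lemma G_log_concave:
  assumes "0 < y"
  shows "g' y * G y < (g y)\<^sup>2"
proof -
  define Q where "Q y = W y * g y - \<alpha> * W y * W' y - \<alpha> * (W' y)\<^sup>2" for y
  define Q' where "Q' y = (1 - \<alpha>) * g y * (W' y + W y) - Q y" for y
  have "0 < Q y"
  proof (rule pos_of_linear_deriv_pos[OF assms, of Q Q' 1])
    fix x :: real assume x: "0 < x"
    have "(Q has_real_derivative
       W' x * g x + W x * g' x - \<alpha> * (W' x * W' x + W x * (g x - W' x)) - 2 * \<alpha> * W' x * (g x - W' x)) (at x)"
      unfolding Q_def[abs_def]
      by (rule derivative_eq_intros W_deriv W'_deriv g_deriv x refl | simp add: g_def algebra_simps power2_eq_square)+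
    also have "W' x * g x + W x * g' x - \<alpha> * (W' x * W' x + W x * (g x - W' x)) - 2 * \<alpha> * W' x * (g x - W' x) = Q' x"
      using W_pos[OF x] by (simp add: Q'_def Q_def g'_def field_simps power2_eq_square)
    finally show "(Q has_real_derivative Q' x) (at x)" .
    show "0 < Q' x + 1 * Q x"
      using W_pos[OF x] W'_pos[OF x] g_pos[OF x] alpha_less_1 by (simp add: Q'_def)
  qed (auto simp: Q_def[abs_def] W_nonpos W'_nonpos intro!: continuous_intros W_cont g_cont)
  \<comment> \<open>\<open>Q\<close> equals \<open>W * g - \<alpha> * W' * G\<close>, so its
    positivity is the claim up to the factor \<open>g / W\<close>.\<close>
  then have "\<alpha> * W' y * G y < W y * g y"
    by (simp add: Q_def G_def algebra_simps power2_eq_square)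
  from mult_strict_left_mono[OF this g_pos[OF assms]]
  show ?thesis
    using W_pos[OF assms] by (simp add: g'_def field_simps power2_eq_square)
qed

text \<open>The lower bound is the value of \<open>A\<close> at which \<open>A / G\<close> would be stationary.\<close>

lemma A_greater:
  assumes y: "0 < y"
  shows "g y * G y / (g y + \<Lambda> * G y) < A y"
proof -
  define B where "B y = g y * G y / (g y + \<Lambda> * G y)" for y
  have den: "0 < g x + \<Lambda> * G x" if "0 < x" for x
    using g_pos[OF that] G_pos[OF that] Lambda_pos by (simp add: add_pos_pos)
  define B' where "B' x = ((g' x * G x + g x * g x) * (g x + \<Lambda> * G x)
      - g x * G x * (g' x + \<Lambda> * g x)) / (g x + \<Lambda> * G x)\<^sup>2" for x
  have B_deriv: "(B has_real_derivative B' x) (at x)" if "0 < x" for x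
    unfolding B_def[abs_def] B'_def using den[OF that]
    by (auto intro!: derivative_eq_intros g_deriv that G_deriv simp: power2_eq_square algebra_simps)
  have B_le: "\<bar>B x\<bar> \<le> G x" if "0 < x" for x
    using g_pos[OF that] G_pos[OF that] Lambda_pos den[OF that]
    by (simp add: B_def field_simps)
  have B_cont: "continuous_on {0..y} B"
  proof (rule continuous_on_IccI)
    have "(B \<longlongrightarrow> 0) (at_right 0)"
    proof (rule Lim_null_comparison[where g=G])
      show "\<forall>\<^sub>F x in at_right 0. norm (B x) \<le> G x"
        using eventually_at_right_less[of 0] by eventually_elim (use B_le in simp)
      have "(G \<longlongrightarrow> 0) (at 0)" using DERIV_isCont[OF G_deriv, of 0] by (simp add: isCont_def)
      then show "(G \<longlongrightarrow> 0) (at_right 0)" by (simp add: filterlim_at_split)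
    qed
    \<comment> \<open>Numerator and denominator both vanish at 0; division by zero returns 0, which
      agrees with the limit.\<close>
    then show "(B \<longlongrightarrow> B 0) (at_right 0)" by (simp add: B_def)
    show "(B \<longlongrightarrow> B y) (at_left y)"
      using DERIV_isCont[OF B_deriv[OF y]] by (simp add: isCont_def filterlim_at_split)
    show "B \<midarrow>x\<rightarrow> B x" if "0 < x" "x < y" for x
      using DERIV_isCont[OF B_deriv[OF that(1)]] by (simp add: isCont_def)
  qed (rule y)
  have "0 < A y - B y"
  proof (rule pos_of_linear_deriv_pos[OF y, of "\<lambda>y. A y - B y" "\<lambda>y. g y - \<Lambda> * A y - B' y" \<Lambda>])
    fix x :: real assume x: "0 < x"
    show "((\<lambda>y. A y - B y) has_real_derivative g x - \<Lambda> * A x - B' x) (at x)"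
      by (intro derivative_intros A_deriv B_deriv x)
    \<comment> \<open>Log-concavity makes \<open>B\<close> a strict subsolution of the equation
      \<open>A' + \<Lambda> * A = g\<close>.\<close>
    have "g x - \<Lambda> * B x - B' x = \<Lambda> * G x * ((g x)\<^sup>2 - g' x * G x) / (g x + \<Lambda> * G x)\<^sup>2"
      using den[OF x] by (simp add: B_def B'_def divide_simps) (simp add: algebra_simps power2_eq_square)
    moreover have "0 < \<dots>"
      using G_pos[OF x] Lambda_pos G_log_concave[OF x] den[OF x] by simp
    ultimately show "0 < g x - \<Lambda> * A x - B' x + \<Lambda> * (A x - B x)"
      by (simp add: algebra_simps)
  next
    show "continuous_on {0..y} (\<lambda>y. A y - B y)" by (intro continuous_intros A_cont B_cont)
  qed (simp add: B_def)
  then show ?thesis by (simp add: B_def)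
qed

text \<open>The derivative of \<open>A / G\<close> has numerator
  \<open>g * G - A * (g + \<Lambda> * G)\<close>, negative by \<open>A_greater\<close>.\<close>

lemma ratio_strict_antimono:
  assumes "0 < x" "x < y"
  shows "A y / G y < A x / G x"
proof (rule DERIV_neg_imp_decreasing[OF assms(2)])
  fix t assume "x \<le> t" "t \<le> y"
  then have t: "0 < t" using assms by simp
  have "g t * G t < A t * (g t + \<Lambda> * G t)"
    using A_greater[OF t] g_pos[OF t] G_pos[OF t] Lambda_pos by (simp add: pos_divide_less_eq add_pos_pos)
  then have "((g t - \<Lambda> * A t) * G t - A t * g t) / (G t * G t) < 0"
    using G_pos[OF t] by (intro divide_neg_pos) (auto simp: algebra_simps)
  moreover have "((\<lambda>t. A t / G t) has_real_derivative ((g t - \<Lambda> * A t) * G t - A t * g t) / (G t * G t)) (at t)"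
    using G_pos[OF t] by (intro DERIV_divide A_deriv G_deriv) simp
  ultimately show "\<exists>d. ((\<lambda>t. A t / G t) has_real_derivative d) (at t) \<and> d < 0"
    by blast
qed

lemma ratio_unique:
  assumes "0 < x" "0 < y" "A x / G x = A y / G y"
  shows "x = y"
  using ratio_strict_antimono[of x y] ratio_strict_antimono[of y x] assms by (metis less_irrefl linorder_neqE)

text \<open>Intermediate values between \<open>a\<close>, where \<open>A_ge\<close> gives a ratio of
  at least \<theta>, and a large \<open>b\<close>, where \<open>A_le\<close> gives a ratio of at
  most \<theta>.\<close>

lemma ratio_attained:
  assumes \<theta>: "0 < \<theta>" "\<theta> < 1"
  obtains S where "0 < S" "A S / G S = \<theta>"
proof -
  define a where "a = - ln \<theta> / \<Lambda>"
  have a: "0 < a" "exp (- \<Lambda> * a) = \<theta>"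
    using \<theta> Lambda_pos by (auto simp: a_def divide_neg_pos)
  have le: "\<theta> \<le> A a / G a"
    using A_ge[of a] a G_pos[of a] by (simp add: pos_le_divide_eq)
  \<comment> \<open>This threshold means
    \<open>W powr (1 - \<alpha>) \<ge> 1 / (\<theta> * \<Lambda>)\<close>, that is
    \<open>g \<le> \<theta> * \<Lambda> * W\<close>, and \<open>W \<le> G\<close>.\<close>
  have "\<forall>\<^sub>F x in at_top. (1 / (\<theta> * \<Lambda>)) powr (1 / (1 - \<alpha>)) \<le> W x"
    using W_at_top by (simp add: filterlim_at_top)
  with eventually_ge_at_top[of a] have "\<forall>\<^sub>F x in at_top. a \<le> x \<and> (1 / (\<theta> * \<Lambda>)) powr (1 / (1 - \<alpha>)) \<le> W x"
    by eventually_elim simp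
  then obtain b where b: "a \<le> b" "(1 / (\<theta> * \<Lambda>)) powr (1 / (1 - \<alpha>)) \<le> W b"
    by (auto simp: eventually_at_top_linorder)
  have "0 < b" using a b by simp
  have "1 / (\<theta> * \<Lambda>) = ((1 / (\<theta> * \<Lambda>)) powr (1 / (1 - \<alpha>))) powr (1 - \<alpha>)"
    using \<theta> Lambda_pos alpha_less_1 by (simp add: powr_powr)
  also have "\<dots> \<le> W b powr (1 - \<alpha>)"
    using b alpha_less_1 by (intro powr_mono2) auto
  finally have "1 \<le> \<theta> * \<Lambda> * W b powr (1 - \<alpha>)"
    using \<theta> Lambda_pos by (simp add: field_simps)
  then have "g b \<le> \<theta> * \<Lambda> * W b powr (1 - \<alpha>) * g b"
    using g_pos[OF \<open>0 < b\<close>] by simp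
  also have "\<dots> = \<theta> * \<Lambda> * W b"
    using W_pos[OF \<open>0 < b\<close>] by (simp add: g_def flip: powr_add)
  also have "\<dots> \<le> \<theta> * \<Lambda> * G b"
    using W'_pos[OF \<open>0 < b\<close>] \<theta> Lambda_pos by (intro mult_left_mono) (auto simp: G_def)
  finally have "\<Lambda> * A b \<le> \<Lambda> * (\<theta> * G b)"
    using A_le[of b] \<open>0 < b\<close> by (simp add: mult_ac)
  then have ge: "A b / G b \<le> \<theta>"
    using Lambda_pos G_pos[OF \<open>0 < b\<close>] by (simp add: pos_divide_le_eq)
  have "continuous_on {a..b} (\<lambda>x. A x / G x)"
    using a G_pos by (intro continuous_intros A_cont G_cont) (auto simp: less_le)
  from IVT2'[OF ge le b(1) this] obtain x where "a \<le> x" "A x / G x = \<theta>" by auto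
  then show thesis using a by (intro that[of x]) auto
qed

end

subsection \<open>Solutions of the free boundary problem\<close>

lemma C2_C1_derivs_restrict:
  assumes "\<And>x. (f has_real_derivative f' x) (at x)" "\<And>x. (f' has_real_derivative f'' x) (at x)"
    and "continuous_on UNIV f''"
  shows "C2_C1_derivs a b (restrict f {a..b}) f' f''"
  unfolding C2_C1_derivs_def
proof (intro conjI ballI)
  fix x assume x: "x \<in> {a..b}"
  show "(restrict f {a..b} has_real_derivative f' x) (at x within {a..b})"
    by (rule has_field_derivative_transform_within[OF has_field_derivative_at_within[OF assms(1)] zero_less_one x]) simp
next
  show "continuous_on {a..b} f'"
    using assms(2) by (meson DERIV_isCont continuous_at_imp_continuous_on)
qed (use assms in \<open>auto intro: continuous_on_subset\<close>)

lemma C2_C1_derivsD: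
  assumes "C2_C1_derivs a b f f' f''"
  shows "continuous_on {a..b} f" "continuous_on {a..b} f'"
    and "\<And>x. a < x \<Longrightarrow> x < b \<Longrightarrow> (f has_real_derivative f' x) (at x)"
    and "\<And>x. a < x \<Longrightarrow> x < b \<Longrightarrow> (f' has_real_derivative f'' x) (at x)"
proof -
  have d: "(f has_real_derivative f' x) (at x within {a..b})" if "x \<in> {a..b}" for x
    using assms that by (simp add: C2_C1_derivs_def)
  then show "continuous_on {a..b} f" by (rule DERIV_continuous_on)
  show "(f has_real_derivative f' x) (at x)" if "a < x" "x < b" for x
    using d[of x] that by (simp add: at_within_Icc_at)
qed (use assms in \<open>auto simp: C2_C1_derivs_def\<close>)

section \<open>Scaling between the profile and the free boundary problem\<close>

context global_profile
begin

lemma profile_on_W: "profile_on S W W'"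
  by (auto simp: profile_on_def W_nonpos W'_nonpos W_pos W_deriv W'_deriv intro!: W_cont)

text \<open>Solves \<open>k powr (1 - \<alpha>) = \<Lambda> / c^2\<close> and
  \<open>k * G S = 1\<close> for \<open>c\<close>; \<open>len\<close> then comes from
  \<open>S = c * R / \<Lambda>\<close>.\<close>

definition vel :: "real \<Rightarrow> real" where "vel S = sqrt (\<Lambda> * G S powr (1 - \<alpha>))"
definition len :: "real \<Rightarrow> real" where "len S = \<Lambda> * S / vel S"

text \<open>The subscripts of these six functions count derivatives in \<xi>. The parameters
  \<open>c\<close> and \<open>k\<close> stay independent here; \<open>scaled_equations\<close>
  imposes the relation between them.\<close>

definition v\<^sub>0 :: "real \<Rightarrow> real \<Rightarrow> real \<Rightarrow> real" where
  "v\<^sub>0 c k \<xi> = k * W (- (c * \<xi> / \<Lambda>))"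
definition v\<^sub>1 :: "real \<Rightarrow> real \<Rightarrow> real \<Rightarrow> real" where
  "v\<^sub>1 c k \<xi> = - (k * c / \<Lambda>) * W' (- (c * \<xi> / \<Lambda>))"
definition v\<^sub>2 :: "real \<Rightarrow> real \<Rightarrow> real \<Rightarrow> real" where
  "v\<^sub>2 c k \<xi> = k * (c / \<Lambda>)\<^sup>2 * (g (- (c * \<xi> / \<Lambda>)) - W' (- (c * \<xi> / \<Lambda>)))"
definition u\<^sub>0 :: "real \<Rightarrow> real \<Rightarrow> real \<Rightarrow> real" where
  "u\<^sub>0 c k \<xi> = 1 - k * (G (- (c * \<xi> / \<Lambda>)) - A (- (c * \<xi> / \<Lambda>)))"
definition u\<^sub>1 :: "real \<Rightarrow> real \<Rightarrow> real \<Rightarrow> real" where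
  "u\<^sub>1 c k \<xi> = c * k * A (- (c * \<xi> / \<Lambda>))"
definition u\<^sub>2 :: "real \<Rightarrow> real \<Rightarrow> real \<Rightarrow> real" where
  "u\<^sub>2 c k \<xi> = - (c\<^sup>2 * k / \<Lambda>) * (g (- (c * \<xi> / \<Lambda>)) - \<Lambda> * A (- (c * \<xi> / \<Lambda>)))"

lemma scaled_deriv:
  assumes "\<And>y. (f has_real_derivative f' y) (at y)"
  shows "((\<lambda>\<xi>. f (- (c * \<xi> / \<Lambda>))) has_real_derivative f' (- (c * \<xi> / \<Lambda>)) * - (c / \<Lambda>)) (at \<xi>)"
  by (rule DERIV_chain2[OF assms]) (use Lambda_pos in \<open>auto intro!: derivative_eq_intros\<close>)

lemma scaled_derivs:
  "(v\<^sub>0 c k has_real_derivative v\<^sub>1 c k \<xi>) (at \<xi>)" "(v\<^sub>1 c k has_real_derivative v\<^sub>2 c k \<xi>) (at \<xi>)"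
  "(u\<^sub>0 c k has_real_derivative u\<^sub>1 c k \<xi>) (at \<xi>)" "(u\<^sub>1 c k has_real_derivative u\<^sub>2 c k \<xi>) (at \<xi>)"
proof -
  have W'_deriv': "(W' has_real_derivative g y - W' y) (at y)" for y
    using W'_deriv by (simp add: g_def)
  show "(v\<^sub>0 c k has_real_derivative v\<^sub>1 c k \<xi>) (at \<xi>)"
    unfolding v\<^sub>0_def[abs_def] v\<^sub>1_def by (rule derivative_eq_intros scaled_deriv[OF W_deriv] refl | simp)+
  show "(v\<^sub>1 c k has_real_derivative v\<^sub>2 c k \<xi>) (at \<xi>)"
    unfolding v\<^sub>1_def[abs_def] v\<^sub>2_def
    by (rule derivative_eq_intros scaled_deriv[OF W'_deriv'] refl | simp add: power2_eq_square)+
  show "(u\<^sub>0 c k has_real_derivative u\<^sub>1 c k \<xi>) (at \<xi>)"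
    unfolding u\<^sub>0_def[abs_def] u\<^sub>1_def
    by (rule derivative_eq_intros scaled_deriv[OF G_deriv] scaled_deriv[OF A_deriv] refl)+
      (use Lambda_pos in \<open>simp add: field_simps\<close>)
  show "(u\<^sub>1 c k has_real_derivative u\<^sub>2 c k \<xi>) (at \<xi>)"
    unfolding u\<^sub>1_def[abs_def] u\<^sub>2_def
    by (rule derivative_eq_intros scaled_deriv[OF A_deriv] refl)+
      (simp add: algebra_simps power2_eq_square)
qed

lemma scaled_continuous: "continuous_on UNIV (u\<^sub>2 c k)" "continuous_on UNIV (v\<^sub>2 c k)"
  unfolding u\<^sub>2_def[abs_def] v\<^sub>2_def[abs_def] using Lambda_pos
  by (auto intro!: continuous_intros continuous_on_compose2[OF g_cont[of UNIV]]
      continuous_on_compose2[OF A_cont[of UNIV]] continuous_on_compose2[OF W_cont(2)[of UNIV]])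

text \<open>With \<open>y = - (c * \<xi> / \<Lambda>)\<close>, the left sides reduce to
  \<open>c^2 * k / \<Lambda> * g y\<close> up to sign, while the reaction term is
  \<open>k powr \<alpha> * g y\<close>. The relation \<open>rel\<close> equates the
  coefficients.\<close>

lemma scaled_equations:
  assumes "0 < k" and rel: "c\<^sup>2 * k = \<Lambda> * k powr \<alpha>"
  shows "u\<^sub>2 c k \<xi> - c * u\<^sub>1 c k \<xi> = - (v\<^sub>0 c k \<xi> powr \<alpha>)"
    and "\<Lambda> * v\<^sub>2 c k \<xi> - c * v\<^sub>1 c k \<xi> = v\<^sub>0 c k \<xi> powr \<alpha>"
proof -
  define y where "y = - (c * \<xi> / \<Lambda>)"
  have eq: "c\<^sup>2 * k / \<Lambda> = k powr \<alpha>" using rel Lambda_pos by simp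
  have v: "v\<^sub>0 c k \<xi> powr \<alpha> = c\<^sup>2 * k / \<Lambda> * g y"
    unfolding eq using \<open>0 < k\<close> W_nonneg[of y] by (simp add: v\<^sub>0_def g_def powr_mult flip: y_def)
  show "u\<^sub>2 c k \<xi> - c * u\<^sub>1 c k \<xi> = - (v\<^sub>0 c k \<xi> powr \<alpha>)"
    unfolding v unfolding u\<^sub>2_def u\<^sub>1_def y_def[symmetric] using Lambda_pos by (simp add: field_simps power2_eq_square)
  show "\<Lambda> * v\<^sub>2 c k \<xi> - c * v\<^sub>1 c k \<xi> = v\<^sub>0 c k \<xi> powr \<alpha>"
    unfolding v unfolding v\<^sub>2_def v\<^sub>1_def y_def[symmetric] using Lambda_pos by (simp add: field_simps power2_eq_square)
qed

lemma scaled_at_0: "v\<^sub>0 c k 0 = 0" "v\<^sub>1 c k 0 = 0" "u\<^sub>0 c k 0 = 1" "u\<^sub>1 c k 0 = 0"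
  by (simp_all add: v\<^sub>0_def v\<^sub>1_def u\<^sub>0_def u\<^sub>1_def W_nonpos W'_nonpos)

lemma vel_pos: "0 < S \<Longrightarrow> 0 < vel S"
  using G_pos[of S] Lambda_pos by (simp add: vel_def)

lemma fbp_solution_scaled:
  assumes S: "0 < S" "A S / G S = \<theta>"
  defines "c \<equiv> vel S" and "R \<equiv> len S" and "k \<equiv> 1 / G S"
  shows "fbp_solution \<theta> \<alpha> \<Lambda> c R (restrict (u\<^sub>0 c k) {-R..0}) (restrict (v\<^sub>0 c k) {-R..0})"
proof -
  note G = G_pos[OF S(1)]
  have pos: "0 < c" "0 < k" "0 < R"
    using vel_pos[OF S(1)] S Lambda_pos G by (auto simp: c_def k_def R_def len_def)
  have "c\<^sup>2 = \<Lambda> * G S powr (1 - \<alpha>)"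
    using Lambda_pos G by (simp add: c_def vel_def)
  then have "c\<^sup>2 * k = \<Lambda> * k powr \<alpha>"
    using G by (simp add: k_def powr_diff powr_divide)
  note eqs = scaled_equations[OF pos(2) this]
  have end_point: "- (c * - R / \<Lambda>) = S"
    using pos Lambda_pos by (simp add: R_def len_def flip: c_def)
  show ?thesis
    unfolding fbp_solution_def
  proof (intro conjI exI)
    show "C2_C1_derivs (- R) 0 (restrict (u\<^sub>0 c k) {-R..0}) (u\<^sub>1 c k) (u\<^sub>2 c k)"
      by (rule C2_C1_derivs_restrict) (rule scaled_derivs scaled_continuous)+
    show "C2_C1_derivs (- R) 0 (restrict (v\<^sub>0 c k) {-R..0}) (v\<^sub>1 c k) (v\<^sub>2 c k)"
      by (rule C2_C1_derivs_restrict) (rule scaled_derivs scaled_continuous)+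
    show "\<forall>\<xi>\<in>{- R<..<0}.
       u\<^sub>2 c k \<xi> - c * u\<^sub>1 c k \<xi> = - (restrict (v\<^sub>0 c k) {- R..0} \<xi> powr \<alpha>) \<and>
       \<Lambda> * v\<^sub>2 c k \<xi> - c * v\<^sub>1 c k \<xi> = restrict (v\<^sub>0 c k) {- R..0} \<xi> powr \<alpha> \<and>
       0 < restrict (v\<^sub>0 c k) {- R..0} \<xi>"
      using eqs pos Lambda_pos
      by (auto simp: v\<^sub>0_def intro!: mult_pos_pos W_pos divide_neg_pos mult_pos_neg)
    show "u\<^sub>1 c k (- R) = c * \<theta>"
      unfolding u\<^sub>1_def end_point using S(2)[symmetric] by (simp add: k_def)
    have "u\<^sub>0 c k (- R) = \<theta>"
      unfolding u\<^sub>0_def end_point using S G by (simp add: k_def field_simps)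
    then show "restrict (u\<^sub>0 c k) {-R..0} (- R) = \<theta>" using pos by simp
  qed (use pos in \<open>auto simp: scaled_at_0\<close>)
qed

text \<open>Uniqueness of the profile determines \<open>v\<close>; the data at 0 then determine
  \<open>u'\<close> and \<open>u\<close> by integration. The two conditions at \<open>-R\<close> fix
  the amplitude and the ratio \<open>A / G\<close>, so everything is expressed through
  \<open>S\<close>.\<close>

lemma fbp_solution_imp_scaled:
  assumes sol: "fbp_solution \<theta> \<alpha> \<Lambda> c R u v"
  obtains S where "0 < S" "A S / G S = \<theta>" "c = vel S" "R = len S"
    "u = restrict (u\<^sub>0 c (1 / G S)) {-R..0}" "v = restrict (v\<^sub>0 c (1 / G S)) {-R..0}"
proof -
  from sol have c: "0 < c" and R: "0 < R" and ext: "u \<in> extensional {-R..0}" "v \<in> extensional {-R..0}"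
    by (auto simp: fbp_solution_def)
  from sol obtain u' u'' v' v'' where u: "C2_C1_derivs (-R) 0 u u' u''" and v: "C2_C1_derivs (-R) 0 v v' v''"
    and eqs: "\<And>\<xi>. -R < \<xi> \<Longrightarrow> \<xi> < 0 \<Longrightarrow> u'' \<xi> - c * u' \<xi> = - (v \<xi> powr \<alpha>)"
      "\<And>\<xi>. -R < \<xi> \<Longrightarrow> \<xi> < 0 \<Longrightarrow> \<Lambda> * v'' \<xi> - c * v' \<xi> = v \<xi> powr \<alpha>"
      "\<And>\<xi>. -R < \<xi> \<Longrightarrow> \<xi> < 0 \<Longrightarrow> 0 < v \<xi>"
    and bc: "u (-R) = \<theta>" "u' (-R) = c * \<theta>" "u 0 = 1" "u' 0 = 0" "v 0 = 0" "v' 0 = 0"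
    by (force simp: fbp_solution_def)
  note u = C2_C1_derivsD[OF u] and v = C2_C1_derivsD[OF v]
  define k where "k = (\<Lambda> / c\<^sup>2) powr (1 / (1 - \<alpha>))"
  have k: "0 < k" "k powr (1 - \<alpha>) = \<Lambda> / c\<^sup>2"
    using c Lambda_pos alpha_less_1 by (simp_all add: k_def powr_powr)
  have "k = k powr (1 - \<alpha>) * k powr \<alpha>"
    using k(1) by (simp flip: powr_add)
  then have rel: "c\<^sup>2 * k = \<Lambda> * k powr \<alpha>"
    unfolding k(2) using c by (simp add: field_simps)
  define S where "S = c * R / \<Lambda>"
  have S: "0 < S" using c R Lambda_pos by (simp add: S_def)
  have img: "- R \<le> - (\<Lambda> * y / c)" "- (\<Lambda> * y / c) \<le> 0" if "0 \<le> y" "y \<le> S" for y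
    using that c Lambda_pos by (auto simp: S_def field_simps)
  have img': "- R < - (\<Lambda> * y / c)" "- (\<Lambda> * y / c) < 0" if "0 < y" "y < S" for y
    using that c Lambda_pos by (auto simp: S_def field_simps)
  define V where "V y = v (- (\<Lambda> * y / c)) / k" for y
  define V' where "V' y = - (\<Lambda> / (c * k)) * v' (- (\<Lambda> * y / c))" for y
  have lin: "((\<lambda>y. - (\<Lambda> * y / c)) has_real_derivative - (\<Lambda> / c)) (at y)" for y
    using c by (auto intro!: derivative_eq_intros)
  have "profile_on S V V'"
    unfolding profile_on_def
  proof (intro conjI ballI)
    show "V 0 = 0" "V' 0 = 0" using bc by (simp_all add: V_def V'_def)
    show "continuous_on {0..S} V" "continuous_on {0..S} V'"
      unfolding V_def V'_def using c k(1)
      by (intro continuous_intros continuous_on_compose2[OF v(1)] continuous_on_compose2[OF v(2)];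
          use img in force)+
    fix y assume "y \<in> {0<..<S}"
    then have y: "0 < y" "y < S" by auto
    define x where "x = - (\<Lambda> * y / c)"
    note x = img'[OF y, folded x_def]
    show "0 < V y" unfolding V_def using eqs(3)[OF x] k(1) by (simp add: x_def)
    have "((\<lambda>y. v (- (\<Lambda> * y / c))) has_real_derivative v' x * - (\<Lambda> / c)) (at y)"
      unfolding x_def by (rule DERIV_chain2[OF _ lin]) (use v(3)[OF x] in \<open>simp add: x_def\<close>)
    from DERIV_cdivide[OF this, of k] show "(V has_real_derivative V' y) (at y)"
      unfolding V_def[abs_def] V'_def by (simp add: x_def mult_ac)
    have "((\<lambda>y. v' (- (\<Lambda> * y / c))) has_real_derivative v'' x * - (\<Lambda> / c)) (at y)"
      unfolding x_def by (rule DERIV_chain2[OF _ lin]) (use v(4)[OF x] in \<open>simp add: x_def\<close>)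
    from DERIV_cmult[OF this, of "- (\<Lambda> / (c * k))"]
    have "(V' has_real_derivative \<Lambda> / (c\<^sup>2 * k) * (\<Lambda> * v'' x)) (at y)"
      unfolding V'_def[abs_def] by (simp add: power2_eq_square mult_ac)
    also have "\<Lambda> * v'' x = v x powr \<alpha> + c * v' x" using eqs(2)[OF x] by simp
    also have "\<Lambda> / (c\<^sup>2 * k) * (v x powr \<alpha> + c * v' x) = V y powr \<alpha> - V' y"
    proof -
      have "\<Lambda> / (c\<^sup>2 * k) * v x powr \<alpha> = V y powr \<alpha>"
        unfolding rel V_def using eqs(3)[OF x] k(1) Lambda_pos by (simp add: powr_divide flip: x_def)
      moreover have "\<Lambda> / (c\<^sup>2 * k) * (c * v' x) = - V' y"
        using c k(1) by (simp add: V'_def power2_eq_square flip: x_def)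
      ultimately show ?thesis by (simp add: distrib_left)
    qed
    finally show "(V' has_real_derivative V y powr \<alpha> - V' y) (at y)" .
  qed
  note VW = profile_on_unique[OF this profile_on_W]
  have v_eq: "v \<xi> = v\<^sub>0 c k \<xi>" if "-R \<le> \<xi>" "\<xi> \<le> 0" for \<xi>
  proof -
    have "0 \<le> c * - \<xi> / \<Lambda>" "c * - \<xi> / \<Lambda> \<le> S"
      unfolding S_def using that c Lambda_pos
      by (intro divide_nonneg_pos mult_nonneg_nonneg divide_right_mono mult_left_mono; simp)+
    then have "V (- (c * \<xi> / \<Lambda>)) = W (- (c * \<xi> / \<Lambda>))"
      by (intro VW) simp_all
    then show ?thesis using c k(1) Lambda_pos by (simp add: V_def v\<^sub>0_def field_simps)
  qed
  have cont: "continuous_on B (u\<^sub>0 c k)" "continuous_on B (u\<^sub>1 c k)" for B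
    using scaled_derivs(3,4) by (meson DERIV_isCont continuous_at_imp_continuous_on)+
  have u'_eq: "u' \<xi> = u\<^sub>1 c k \<xi>" if "-R \<le> \<xi>" "\<xi> \<le> 0" for \<xi>
  proof -
    \<comment> \<open>With \<open>v\<close> identified, \<open>u'\<close> and
      \<open>u\<^sub>1\<close> solve the same first-order linear equation. The integrating factor
      makes \<open>h\<close> constant, and \<open>h\<close> vanishes at 0.\<close>
    define h where "h \<xi> = exp (- c * \<xi>) * (u' \<xi> - u\<^sub>1 c k \<xi>)" for \<xi>
    have const: "h x = h (-R)" if "-R \<le> x" "x \<le> 0" for x
    proof (rule DERIV_isconst2[where f=h and b=0])
      show "continuous_on {-R..0} h"
        unfolding h_def by (intro continuous_intros u cont)
      fix x assume x: "-R < x" "x < 0"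
      have "(h has_real_derivative
          exp (- c * x) * ((u'' x - c * u' x) - (u\<^sub>2 c k x - c * u\<^sub>1 c k x))) (at x)"
        unfolding h_def[abs_def]
        by (rule derivative_eq_intros u x scaled_derivs refl | simp add: algebra_simps)+
      also have "(u'' x - c * u' x) - (u\<^sub>2 c k x - c * u\<^sub>1 c k x) = 0"
        using eqs(1)[OF x] v_eq[of x] x scaled_equations(1)[OF k(1) rel, of x] by simp
      finally show "(h has_real_derivative 0) (at x)" by simp
    qed (use R that in auto)
    have "h \<xi> = h 0" using const[OF that] const[of 0] R by simp
    then show ?thesis using bc by (simp add: h_def scaled_at_0)
  qed
  have u_eq: "u \<xi> = u\<^sub>0 c k \<xi>" if "-R \<le> \<xi>" "\<xi> \<le> 0" for \<xi>
  proof -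
    have const: "u x - u\<^sub>0 c k x = u (-R) - u\<^sub>0 c k (-R)" if "-R \<le> x" "x \<le> 0" for x
    proof (rule DERIV_isconst2[where f="\<lambda>x. u x - u\<^sub>0 c k x" and b=0])
      show "continuous_on {-R..0} (\<lambda>x. u x - u\<^sub>0 c k x)" by (intro continuous_intros u cont)
      fix x assume x: "-R < x" "x < 0"
      show "((\<lambda>x. u x - u\<^sub>0 c k x) has_real_derivative 0) (at x)"
        using DERIV_diff[OF u(3)[OF x] scaled_derivs(3), of c k] u'_eq[of x] x by simp
    qed (use R that in auto)
    show ?thesis using const[OF that] const[of 0] R bc by (simp add: scaled_at_0)
  qed
  have end_point: "- (c * - R / \<Lambda>) = S" by (simp add: S_def)
  have kA: "k * A S = \<theta>"
    using u'_eq[of "-R"] R bc c unfolding u\<^sub>1_def end_point by simp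
  moreover have "\<theta> = 1 - k * (G S - A S)"
    using u_eq[of "-R"] R bc unfolding u\<^sub>0_def end_point by simp
  ultimately have kG: "k * G S = 1" by (simp add: algebra_simps)
  note G = G_pos[OF S]
  have k_eq: "k = 1 / G S" using kG G by (simp add: field_simps)
  have "\<Lambda> * G S powr (1 - \<alpha>) = c\<^sup>2"
    using k(2) c Lambda_pos G unfolding k_eq by (simp add: powr_divide field_simps)
  then have c_eq: "c = vel S" using c by (simp add: vel_def)
  show thesis
  proof (rule that[OF S _ c_eq])
    show "A S / G S = \<theta>" using kA by (simp add: k_eq)
    show "R = len S" unfolding len_def c_eq[symmetric] using c Lambda_pos by (simp add: S_def)
    show "u = restrict (u\<^sub>0 c (1 / G S)) {-R..0}" "v = restrict (v\<^sub>0 c (1 / G S)) {-R..0}"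
      using ext u_eq v_eq unfolding k_eq[symmetric] by (auto simp: fun_eq_iff extensional_def)
  qed
qed

end

theorem theorem2p1:
  fixes \<theta> \<alpha> \<Lambda> :: real
  assumes "0 < \<theta>" "\<theta> < 1"
    and "0 < \<alpha>" "\<alpha> < 1"
    and "0 < \<Lambda>"
  shows "\<exists>!p :: real \<times> real \<times> (real \<Rightarrow> real) \<times> (real \<Rightarrow> real).
           case p of (c, R, u, v) \<Rightarrow> fbp_solution \<theta> \<alpha> \<Lambda> c R u v"
proof -
  interpret sublinear \<alpha> by standard (use assms in auto)
  obtain W W' where "global_profile \<alpha> W W' \<Lambda>"
    by (rule profile_exists)
       (use assms in \<open>auto simp: global_profile_def global_profile_axioms_def sublinear_def\<close>)
  then interpret global_profile \<alpha> W W' \<Lambda> .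
  obtain S where S: "0 < S" "A S / G S = \<theta>" using ratio_attained assms by blast
  show ?thesis
  proof (rule ex1I)
    show "case (vel S, len S, restrict (u\<^sub>0 (vel S) (1 / G S)) {- len S..0},
        restrict (v\<^sub>0 (vel S) (1 / G S)) {- len S..0}) of
        (c, R, u, v) \<Rightarrow> fbp_solution \<theta> \<alpha> \<Lambda> c R u v"
      using fbp_solution_scaled[OF S] by simp
  next
    fix p :: "real \<times> real \<times> (real \<Rightarrow> real) \<times> (real \<Rightarrow> real)"
    assume "case p of (c, R, u, v) \<Rightarrow> fbp_solution \<theta> \<alpha> \<Lambda> c R u v"
    then obtain c R u v where p: "p = (c, R, u, v)" and sol: "fbp_solution \<theta> \<alpha> \<Lambda> c R u v"
      by (cases p) auto
    from fbp_solution_imp_scaled[OF sol] obtain T where T: "0 < T" "A T / G T = \<theta>" "c = vel T" "R = len T"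
      "u = restrict (u\<^sub>0 c (1 / G T)) {-R..0}" "v = restrict (v\<^sub>0 c (1 / G T)) {-R..0}" .
    \<comment> \<open>Strict monotonicity of \<open>A / G\<close> enters here; all four components
      are functions of this one parameter.\<close>
    have "T = S" using ratio_unique[OF T(1) S(1)] T(2) S(2) by simp
    then show "p = (vel S, len S, restrict (u\<^sub>0 (vel S) (1 / G S)) {- len S..0},
        restrict (v\<^sub>0 (vel S) (1 / G S)) {- len S..0})"
      using T p by simp
  qed
qed

end
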